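(* Let $d\geq1$, let $(\boldsymbol{\ell}_m)_{m\geq0}$ be a sequence of vectors in $\mathbb{Z}_{\geq0}^d$ and $(\ell'_m)_{m\geq0}$ a sequence of non-negative integers with $\ell'_m<\overline{\boldsymbol{\ell}_m}$ for all $m$, and let $C_\infty$ be a $\left((q^{\boldsymbol{\ell}_m})_{m\ge0},(q^{\ell'_m})_{m\ge0}\right)$ Cantor set. If \[\min_{1\le s\le d}\sum_{k=0}^{m-1}\ell_k^s\xrightarrow[m\to\infty]{}\infty,\] then \[\dim(C_\infty)\geq d-\limsup_{m\to\infty}\frac{m+1}{\min_{1\le s\le d}\sum_{k=0}^{m-1}\ell_k^s}\cdot\frac{\log\frac{q}{q-1}}{\log q}.\]
   Context: $q$ is a prime power; $\mathbb{F}_q((1/t))$ is the field of Laurent series $\theta=\sum_{i}\theta_it^{-i}$ over $\mathbb{F}_q$ with finitely many nonzero coefficients of positive powers of $t$, with absolute value $|\theta|=q^{\deg\theta}$ ($\deg\theta=\max\{-i:\theta_i\ne0\}$), and $I=\{\theta:|\theta|<1\}$. On $\mathbb{F}_q((1/t))^d$ use the metric $\rho(\boldsymbol{\theta},\boldsymbol{\varphi})=\max_s|\theta^s-\varphi^s|$; $\dim$ denotes Hausdorff dimension. For $\boldsymbol{\ell}=(\ell^1,\dots,\ell^d)\in\mathbb{Z}_{\ge0}^d$ let $\overline{\boldsymbol{\ell}}=\sum_s\ell^s$ and define $\pi_{\boldsymbol{\ell}}(\boldsymbol{\theta})=(\theta^1_1,\dots,\theta^1_{\ell^1},\dots,\theta^d_1,\dots,\theta^d_{\ell^d})\in\mathbb{F}_q^{\overline{\boldsymbol{\ell}}}$.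 A cylinder of length $\boldsymbol{\ell}$ is a set $[\mathbf{v}]=\{\boldsymbol{\theta}\in I^d:\pi_{\boldsymbol{\ell}}(\boldsymbol{\theta})=\mathbf{v}\}$ for $\mathbf{v}\in\mathbb{F}_q^{\overline{\boldsymbol{\ell}}}$. For $\mathbf{h}\in\mathbb{Z}_{\ge0}^d$ and a collection $\mathcal{C}$ of cylinders, $q^{-\mathbf{h}}\mathcal{C}$ is the collection of all cylinders $[\mathbf{u}]$ of length $\boldsymbol{\ell}+\mathbf{h}$ contained in some cylinder of $\mathcal{C}$ of length $\boldsymbol{\ell}$ (i.e. whose first-$\boldsymbol{\ell}$ projection gives a member of $\mathcal{C}$). A $\left((q^{\boldsymbol{\ell}_m})_{m},(q^{\ell'_m})_{m}\right)$ Cantor construction is a sequence of collections $\mathcal{C}_m$ with $\mathcal{C}_0=\{I^d\}$, $\mathcal{C}_{m+1}\subseteq q^{-\boldsymbol{\ell}_m}\mathcal{C}_m$, and such that for every $m\ge0$ and every $C\in\mathcal{C}_m$, exactly $q^{\ell'_m}$ of the cylinders in $q^{-\boldsymbol{\ell}_m}\{C\}$ do not belong to $\mathcal{C}_{m+1}$. Its limit set $C_\infty=\bigcap_{m\ge0}\bigcup_{C\in\mathcal{C}_m}C$ is called a $\left((q^{\boldsymbol{\ell}_m})_{m},(q^{\ell'_m})_{m}\right)$ Cantor set. *)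

theory Defs
  imports
    "HOL-Analysis.Analysis"
    "HOL-Computational_Algebra.Formal_Laurent_Series"
begin

section \<open>Hausdorff dimension with respect to an explicit metric\<close>

text \<open>
  The metric is a parameter rather than the one of the class \<^class>\<open>metric_space\<close>: the library
  metric on formal Laurent series uses the base 2 instead of the cardinality \<open>q\<close> of the
  coefficient field, which changes Hausdorff dimensions.
\<close>

definition diam_wrt :: "('a \<Rightarrow> 'a \<Rightarrow> real) \<Rightarrow> 'a set \<Rightarrow> ennreal" where
  "diam_wrt \<rho> U = (SUP x\<in>U. SUP y\<in>U. ennreal (\<rho> x y))"

text \<open>
  The \<open>s\<close>-th power of the diameter, for \<open>s \<ge> 0\<close> and \<open>U\<close> of finite diameter, with the usual
  conventions: the empty set contributes 0, and a nonempty set contributes 1 if \<open>s = 0\<close>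
  (whereas \<open>0 powr 0 = 0\<close> in HOL).
\<close>

definition diam_power :: "('a \<Rightarrow> 'a \<Rightarrow> real) \<Rightarrow> real \<Rightarrow> 'a set \<Rightarrow> ennreal" where
  "diam_power \<rho> s U =
     (if U = {} then 0
      else if s = 0 then 1
      else ennreal (enn2real (diam_wrt \<rho> U) powr s))"

definition hausdorff_premeasure ::
    "('a \<Rightarrow> 'a \<Rightarrow> real) \<Rightarrow> real \<Rightarrow> real \<Rightarrow> 'a set \<Rightarrow> ennreal" where
  "hausdorff_premeasure \<rho> s \<delta> E =
     Inf {(\<Sum>i. diam_power \<rho> s (U i)) | U :: nat \<Rightarrow> 'a set.
            E \<subseteq> (\<Union>i. U i) \<and> (\<forall>i. diam_wrt \<rho> (U i) \<le> ennreal \<delta>)}"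

definition hausdorff_measure ::
    "('a \<Rightarrow> 'a \<Rightarrow> real) \<Rightarrow> real \<Rightarrow> 'a set \<Rightarrow> ennreal" where
  "hausdorff_measure \<rho> s E = (SUP \<delta>\<in>{0<..}. hausdorff_premeasure \<rho> s \<delta> E)"

definition hausdorff_dim :: "('a \<Rightarrow> 'a \<Rightarrow> real) \<Rightarrow> 'a set \<Rightarrow> ereal" where
  "hausdorff_dim \<rho> E = Inf {ereal s | s. 0 \<le> s \<and> hausdorff_measure \<rho> s E = 0}"


section \<open>Laurent series in \<open>1/t\<close> over a finite field\<close>

text \<open>
  \<open>\<bbbF>\<^sub>q((1/t))\<close> is rendered as \<^typ>\<open>'a fls\<close> for a finite field \<^typ>\<open>'a\<close> with \<open>q = CARD('a)\<close>, the
  variable of the series being \<open>1/t\<close>. So \<open>fls_nth \<theta> i\<close> is the coefficient \<open>\<theta>\<^sub>i\<close> of \<open>t\<^sup>-\<^sup>i\<close>, and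
  \<open>deg \<theta> = - fls_subdegree \<theta>\<close> for \<open>\<theta> \<noteq> 0\<close>.
  Vectors of length \<open>d\<close> are indexed by a finite type \<^typ>\<open>'d\<close> with \<open>d = CARD('d)\<close>.
\<close>

definition laurent_abs :: "'a::{field,finite} fls \<Rightarrow> real" where
  "laurent_abs \<theta> =
     (if \<theta> = 0 then 0 else real CARD('a) powi (- fls_subdegree \<theta>))"

definition laurent_dist ::
    "'a::{field,finite} fls ^ 'd \<Rightarrow> 'a fls ^ 'd \<Rightarrow> real" where
  "laurent_dist \<theta> \<phi> = Max (range (\<lambda>s. laurent_abs (\<theta> $ s - \<phi> $ s)))"

definition unit_cube :: "('a::{field,finite} fls ^ 'd) set" where
  "unit_cube = {\<theta>. \<forall>s. laurent_abs (\<theta> $ s) < 1}"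


section \<open>Cylinders and Cantor sets\<close>

definition total_length :: "nat ^ 'd \<Rightarrow> nat" where
  "total_length l = (\<Sum>s\<in>UNIV. l $ s)"

text \<open>
  The coordinates of \<open>\<bbbF>\<^sub>q\<close>-vectors of length \<open>total_length l\<close> are labelled by the pairs \<open>(s, i)\<close>
  with \<open>1 \<le> i \<le> l $ s\<close>.
\<close>

definition coords :: "nat ^ 'd \<Rightarrow> ('d \<times> nat) set" where
  "coords l = (SIGMA s:UNIV. {1..l $ s})"

definition coord_proj ::
    "nat ^ 'd \<Rightarrow> 'a::{field,finite} fls ^ 'd \<Rightarrow> 'd \<times> nat \<Rightarrow> 'a" where
  "coord_proj l \<theta> = restrict (\<lambda>(s, i). fls_nth (\<theta> $ s) (int i)) (coords l)"

definition cylinder ::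
    "nat ^ 'd \<Rightarrow> ('d \<times> nat \<Rightarrow> 'a) \<Rightarrow> ('a::{field,finite} fls ^ 'd) set" where
  "cylinder l v = {\<theta> \<in> unit_cube. coord_proj l \<theta> = v}"

definition cylinders :: "nat ^ 'd \<Rightarrow> ('a::{field,finite} fls ^ 'd) set set" where
  "cylinders l = cylinder l ` (coords l \<rightarrow>\<^sub>E UNIV)"

text \<open>
  The collection \<open>q\<^sup>-\<^sup>h \<C>\<close>. Since \<open>q \<ge> 2\<close>, a cylinder as a set determines its length, so the
  length \<open>l\<close> below is the length of \<open>C\<close>.
\<close>

definition refine_cylinders ::
    "nat ^ 'd \<Rightarrow> ('a::{field,finite} fls ^ 'd) set set \<Rightarrow> ('a fls ^ 'd) set set" where
  "refine_cylinders h \<C> =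
     {D. \<exists>l. \<exists>C\<in>\<C>. C \<in> cylinders l \<and> D \<in> cylinders (l + h) \<and> D \<subseteq> C}"

text \<open>The parameters are the exponents of \<open>q\<close> in the two sequences.\<close>

definition cantor_construction ::
    "(nat \<Rightarrow> nat ^ 'd) \<Rightarrow> (nat \<Rightarrow> nat) \<Rightarrow>
     (nat \<Rightarrow> ('a::{field,finite} fls ^ 'd) set set) \<Rightarrow> bool" where
  "cantor_construction l l' \<C> \<longleftrightarrow>
     \<C> 0 = {unit_cube} \<and>
     (\<forall>m. \<C> (Suc m) \<subseteq> refine_cylinders (l m) (\<C> m)) \<and>
     (\<forall>m. \<forall>C\<in>\<C> m. card (refine_cylinders (l m) {C} - \<C> (Suc m)) = CARD('a) ^ l' m)"

definition is_cantor_set ::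
    "(nat \<Rightarrow> nat ^ 'd) \<Rightarrow> (nat \<Rightarrow> nat) \<Rightarrow> ('a::{field,finite} fls ^ 'd) set \<Rightarrow> bool" where
  "is_cantor_set l l' X \<longleftrightarrow>
     (\<exists>\<C>. cantor_construction l l' \<C> \<and> X = (\<Inter>m. \<Union>C\<in>\<C> m. C))"

text \<open>The quantity \<open>min\<^sub>s (l\<^sub>0\<^sup>s + \<dots> + l\<^sub>m\<^sub>-\<^sub>1\<^sup>s)\<close>.\<close>

definition min_partial_sum :: "(nat \<Rightarrow> nat ^ 'd) \<Rightarrow> nat \<Rightarrow> nat" where
  "min_partial_sum l m = Min (range (\<lambda>s. \<Sum>k<m. l k $ s))"

end

theory Submission
  imports Defs "HOL-Real_Asymp.Real_Asymp"
begin

text \<open>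
  Give each \<open>C \<in> \<C> m\<close> the mass \<open>1 / (\<Prod>k<m. K k)\<close>, where \<open>K k = q ^ total_length (l k) - q ^ l' k\<close> is the
  number of children at stage \<open>k\<close>. Since \<open>l' k < total_length (l k)\<close>, a cube of side \<open>q\<^sup>-\<^sup>r\<close> has mass
  at most \<open>(q / (q - 1)) ^ n * q powr (- d * r)\<close>, where \<open>n\<close> is the first stage whose cylinders have length
  at least \<open>r\<close> in every coordinate; by the choice of \<open>n\<close>, this is \<open>O(q powr ((a - d) * r))\<close> for
  every \<open>a\<close> above the upper limit. So a cover of small \<open>s\<close>-dimensional cost, \<open>s < d - a\<close>, enlarges to
  countably many cubes of total mass below 1. No measure and no compactness is needed to contradict this:
  if the cubes cover less than the mass of a cylinder, then the same is true of one of its children,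
  and descending through such children leads to a point of the Cantor set outside all the cubes.
\<close>

unbundle no Formal_Power_Series.fps_syntax

section \<open>Descent in a weighted tree along a branch avoiding small sets\<close>

text \<open>The mass of \<open>C\<close> inside \<open>U i\<close> is additive over the children of
  \<open>C\<close>, so if these masses sum over \<open>i\<close> to less than the mass of
  \<open>C\<close>, the same holds for some child. At level \<open>n i\<close> the set
  \<open>U i\<close> is resolved, which makes its mass a finite count. Only a branch is produced; a
  point on it is found separately.\<close>

lemma tree_avoid:
  fixes T :: "nat \<Rightarrow> 'b set set" and K n :: "nat \<Rightarrow> nat" and U :: "nat \<Rightarrow> 'b set"
  assumes root: "T 0 = {X}"
    and finite_level: "\<And>m. finite (T m)"
    and nonempty: "\<And>m. {} \<notin> T m"
    and disjoint: "\<And>m C D. C \<in> T m \<Longrightarrow> D \<in> T m \<Longrightarrow> C \<inter> D \<noteq> {} \<Longrightarrow> C = D"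
    and parent: "\<And>m D. D \<in> T (Suc m) \<Longrightarrow> \<exists>C\<in>T m. D \<subseteq> C"
    and children: "\<And>m C. C \<in> T m \<Longrightarrow> card {D \<in> T (Suc m). D \<subseteq> C} = K m"
    and K_pos: "\<And>m. K m > 0"
    and dichotomy: "\<And>i D. D \<in> T (n i) \<Longrightarrow> D \<subseteq> U i \<or> D \<inter> U i = {}"
    and small: "(\<Sum>i. ennreal (real (card {D \<in> T (n i). D \<subseteq> U i}) / real (\<Prod>k<n i. K k))) < 1"
  shows "\<exists>c. (\<forall>m. c m \<in> T m \<and> c (Suc m) \<subseteq> c m) \<and> (\<forall>m i. \<not> c m \<subseteq> U i)"
proof -
  define w where "w m = 1 / real (\<Prod>k<m. K k)" for m
  \<comment> \<open>The mass of \<open>C \<inter> U i\<close>, counted at level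
    \<open>max m (n i)\<close>, where each node is inside or disjoint from \<open>C\<close>, and
    likewise for \<open>U i\<close>.\<close>
  define \<nu> where
    "\<nu> m C i = real (card {D \<in> T (max m (n i)). D \<subseteq> C \<inter> U i}) * w (max m (n i))" for m C i
  have w_pos: "w m > 0" for m
    using K_pos by (auto simp: w_def intro!: divide_pos_pos prod_pos)
  have w_Suc: "real (K m) * w (Suc m) = w m" for m
    using K_pos[of m] by (simp add: w_def)
  have \<nu>_nonneg: "\<nu> m C i \<ge> 0" for m C i
    using w_pos[of "max m (n i)"] by (simp add: \<nu>_def)
  have ancestor: "\<exists>C\<in>T m. D \<subseteq> C" if "m \<le> N" "D \<in> T N" for m N D
    using that
  proof (induction N arbitrary: D rule: dec_induct)
    case (step N)
    then show ?case by (meson parent order_trans)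
  qed auto
  have subset_unique: "D = C" if "D \<in> T m" "C \<in> T m" "D \<subseteq> C" for m C D
    using that nonempty[of m] disjoint[OF that(1,2)] by (cases "D = {}") (auto simp: Int_absorb2)
  have dich: "C \<subseteq> U i \<or> C \<inter> U i = {}" if "n i \<le> m" "C \<in> T m" for m i C
    using ancestor[OF that] dichotomy[of _ i] by blast
  \<comment> \<open>While \<open>Suc m \<le> n i\<close>, both sides count the same nodes of level
    \<open>n i\<close>, sorted by the child containing them. From level \<open>n i\<close> on, nodes
    lie wholly inside or outside \<open>U i\<close>, and only \<open>K m * w (Suc m) = w m\<close>
    remains.\<close>
  have additive: "\<nu> m C i = (\<Sum>D | D \<in> T (Suc m) \<and> D \<subseteq> C. \<nu> (Suc m) D i)"
    if C: "C \<in> T m" for m C i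
  proof (cases "Suc m \<le> n i")
    case True
    let ?E = "\<lambda>D. {E \<in> T (n i). E \<subseteq> D \<inter> U i}"
    let ?ch = "{D \<in> T (Suc m). D \<subseteq> C}"
    have "?E C = (\<Union>D\<in>?ch. ?E D)"
    proof (intro subset_antisym subsetI)
      fix E assume E: "E \<in> ?E C"
      then obtain D where D: "D \<in> T (Suc m)" "E \<subseteq> D"
        using ancestor[OF True, of E] by blast
      obtain C' where C': "C' \<in> T m" "D \<subseteq> C'" using parent[OF D(1)] by blast
      have "E \<noteq> {}" using E nonempty by auto
      with D C' E have "C \<inter> C' \<noteq> {}" by blast
      then have "C = C'" using C C' disjoint by blast
      then show "E \<in> (\<Union>D\<in>?ch. ?E D)" using D C' E by blast
    qed auto
    moreover have "card (\<Union>D\<in>?ch. ?E D) = (\<Sum>D\<in>?ch. card (?E D))"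
    proof (rule card_UN_disjoint)
      show "\<forall>D\<in>?ch. \<forall>D'\<in>?ch. D \<noteq> D' \<longrightarrow> ?E D \<inter> ?E D' = {}"
      proof (intro ballI impI)
        fix D D' assume "D \<in> ?ch" "D' \<in> ?ch" "D \<noteq> D'"
        then have "D \<inter> D' = {}" using disjoint by blast
        then show "?E D \<inter> ?E D' = {}" using nonempty[of "n i"]
          by (auto simp: disjoint_iff) (metis subset_iff all_not_in_conv)
      qed
    qed (use finite_level in auto)
    ultimately show ?thesis
      using True by (simp add: \<nu>_def max_def sum_distrib_right)
  next
    case False
    then have le: "n i \<le> m" by simp
    have *: "\<nu> k B i = (if B \<subseteq> U i then w k else 0)" if "n i \<le> k" "B \<in> T k" for k B
    proof (cases "B \<subseteq> U i")
      case True
      have "{D \<in> T k. D \<subseteq> B \<inter> U i} = {B}"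
        using True that(2) subset_unique by auto
      then show ?thesis using that True by (simp add: \<nu>_def max_def)
    next
      case False
      then have "B \<inter> U i = {}" using dich that by blast
      then have empty: "{D \<in> T k. D \<subseteq> B \<and> D \<subseteq> U i} = {}"
        using nonempty[of k] by (auto simp flip: Int_subset_iff)
      show ?thesis using that False by (simp add: \<nu>_def max_def empty)
    qed
    show ?thesis
    proof (cases "C \<subseteq> U i")
      case True
      have "(\<Sum>D | D \<in> T (Suc m) \<and> D \<subseteq> C. \<nu> (Suc m) D i)
          = (\<Sum>D | D \<in> T (Suc m) \<and> D \<subseteq> C. w (Suc m))"
        using True le by (intro sum.cong) (auto simp: *)
      also have "\<dots> = w m" using children[OF C] w_Suc by simp
      finally show ?thesis using * C le True by simp
    next
      case False
      then have "C \<inter> U i = {}" using dich C le by blast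
      then have "\<not> D \<subseteq> U i" if "D \<in> T (Suc m)" "D \<subseteq> C" for D
        using that nonempty[of "Suc m"] by (metis Int_greatest subset_empty)
      then show ?thesis using * C le False by simp
    qed
  qed
  \<comment> \<open>The invariant of the descent; at the root it is the assumption
    \<open>small\<close>.\<close>
  define P where "P m C \<longleftrightarrow> C \<in> T m \<and> (\<Sum>i. ennreal (\<nu> m C i)) < ennreal (w m)" for m C
  have "\<exists>c. \<forall>m. P m (c m) \<and> c (Suc m) \<subseteq> c m"
  proof (rule dependent_nat_choice)
    have "{D \<in> T (n i). D \<subseteq> X \<inter> U i} = {D \<in> T (n i). D \<subseteq> U i}" for i
      using ancestor[of 0 "n i"] root by auto
    then show "\<exists>C. P 0 C" using small root by (auto simp: P_def \<nu>_def w_def)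
  next
    fix C m assume P: "P m C"
    let ?ch = "{D \<in> T (Suc m). D \<subseteq> C}"
    have C: "C \<in> T m" using P by (simp add: P_def)
    have "\<exists>D\<in>?ch. (\<Sum>i. ennreal (\<nu> (Suc m) D i)) < ennreal (w (Suc m))"
    proof (rule ccontr)
      assume "\<not> ?thesis"
      \<comment> \<open>If every child fails, adding up the failures gives at least
        \<open>w m\<close>, while additivity returns the sum for \<open>C\<close>, which is below
        \<open>w m\<close>.\<close>
      then have "(\<Sum>D\<in>?ch. ennreal (w (Suc m))) \<le> (\<Sum>D\<in>?ch. (\<Sum>i. ennreal (\<nu> (Suc m) D i)))"
        by (intro sum_mono) (auto simp: not_less)
      also have "\<dots> = (\<Sum>i. \<Sum>D\<in>?ch. ennreal (\<nu> (Suc m) D i))"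
        by (rule suminf_sum[symmetric]) simp
      also have "\<dots> = (\<Sum>i. ennreal (\<nu> m C i))"
        using additive[OF C] \<nu>_nonneg by (simp add: sum_ennreal)
      also have "\<dots> < ennreal (w m)" using P by (simp add: P_def)
      also have "ennreal (w m) = (\<Sum>D\<in>?ch. ennreal (w (Suc m)))"
        using children[OF C] w_Suc[of m] w_pos[of "Suc m"]
        by (simp add: ennreal_of_nat_eq_real_of_nat flip: ennreal_mult)
      finally show False by simp
    qed
    then show "\<exists>D. P (Suc m) D \<and> D \<subseteq> C" by (auto simp: P_def)
  qed
  then obtain c where c: "\<And>m. P m (c m)" "\<And>m. c (Suc m) \<subseteq> c m" by blast
  have anti: "c N \<subseteq> c m" if "m \<le> N" for m N
    using lift_Suc_antimono_le[of c, OF c(2) that] .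
  have False if sub: "c m \<subseteq> U i" for m i
  proof -
    \<comment> \<open>At a level beyond both \<open>m\<close> and \<open>n i\<close> the node still
      lies in \<open>U i\<close>, so the single term \<open>i\<close> uses up its whole
      weight.\<close>
    define N where "N = max m (n i)"
    have N: "c N \<in> T N" "c N \<subseteq> U i" "n i \<le> N"
      using c(1)[of N] anti[of m N] sub by (auto simp: P_def N_def)
    have "{D \<in> T N. D \<subseteq> c N \<inter> U i} = {c N}"
      using N subset_unique by auto
    then have "\<nu> N (c N) i = w N" using N by (simp add: \<nu>_def max_def)
    moreover have "ennreal (\<nu> N (c N) i) \<le> (\<Sum>j. ennreal (\<nu> N (c N) j))"
      using sum_le_suminf[of "\<lambda>j. ennreal (\<nu> N (c N) j)" "{i}"] by simp
    ultimately show False using c(1)[of N] by (simp add: P_def not_less[symmetric])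
  qed
  then show ?thesis using c unfolding P_def by blast
qed

section \<open>Absolute value and digits of Laurent series\<close>

lemma card_field_ge_2: "CARD('a::{field,finite}) \<ge> 2"
  using card_mono[of "UNIV :: 'a set" "{0, 1}"] by simp

text \<open>Nonzero absolute values are integer powers of q, so a strict bound only says where the
  series may start. \<open>k = 0\<close> describes the unit cube; \<open>k = - int t\<close>,
  applied to a difference, gives agreement of digits up to t.\<close>

lemma laurent_abs_less_iff:
  fixes \<theta> :: "'a::{field,finite} fls"
  shows "laurent_abs \<theta> < real CARD('a) powi k \<longleftrightarrow> (\<forall>i\<le>-k. fls_nth \<theta> i = 0)"
proof (cases "\<theta> = 0")
  case False
  have q: "1 < real CARD('a)" using card_field_ge_2[where 'a='a] by simp
  have "laurent_abs \<theta> < real CARD('a) powi k \<longleftrightarrow> - fls_subdegree \<theta> < k"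
    using q False by (metis laurent_abs_def power_int_strict_increasing power_int_increasing
        less_imp_le not_le)
  also have "\<dots> \<longleftrightarrow> (\<forall>i\<le>-k. fls_nth \<theta> i = 0)"
  proof
    assume "\<forall>i\<le>-k. fls_nth \<theta> i = 0"
    then show "- fls_subdegree \<theta> < k"
      using nth_fls_subdegree_nonzero[OF False] by (meson le_minus_iff not_le)
  qed (auto intro!: fls_eq0_below_subdegree)
  finally show ?thesis .
qed (use card_field_ge_2[where 'a='a] in \<open>simp add: laurent_abs_def\<close>)

lemma unit_cube_iff:
  fixes \<theta> :: "'a::{field,finite} fls ^ 'd"
  shows "\<theta> \<in> unit_cube \<longleftrightarrow> (\<forall>s. \<forall>i\<le>0. fls_nth (\<theta> $ s) i = 0)"
  using laurent_abs_less_iff[where 'a='a and k = 0] by (simp add: unit_cube_def)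

text \<open>Index 0 gets the value 0 to stay in the unit cube. For extensional \<open>f\<close> the
  digits off its domain are \<open>undefined\<close>; projections onto the domain do not see
  them.\<close>

definition point_of :: "('d \<times> nat \<Rightarrow> 'a) \<Rightarrow> 'a::{field,finite} fls ^ 'd" where
  "point_of f = (\<chi> s. fps_to_fls (Abs_fps (\<lambda>i. if i = 0 then 0 else f (s, i))))"

lemma point_of_nth: "i > 0 \<Longrightarrow> fls_nth (point_of f $ s) (int i) = f (s, i)"
  by (simp add: point_of_def)

lemma point_of_in_unit_cube: "point_of f \<in> unit_cube"
  by (auto simp: unit_cube_iff point_of_def)

section \<open>Cylinders: nesting, lengths and counting\<close>

lemma mem_coords_iff: "(s, i) \<in> coords L \<longleftrightarrow> 1 \<le> i \<and> i \<le> L $ s"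
  by (simp add: coords_def)

lemma finite_coords: "finite (coords L)"
  by (simp add: coords_def finite_SigmaI)

lemma card_coords: "card (coords L) = total_length L"
  by (simp add: coords_def total_length_def)

lemma coords_mono:
  fixes L L' :: "nat ^ 'd"
  assumes "\<And>s. L $ s \<le> L' $ s"
  shows "coords L \<subseteq> coords L'"
proof
  fix p assume "p \<in> coords L"
  then show "p \<in> coords L'"
    using assms[of "fst p"] by (cases p) (simp add: mem_coords_iff)
qed

lemma coord_proj_point_of:
  assumes "v \<in> coords L \<rightarrow>\<^sub>E UNIV" shows "coord_proj L (point_of v) = v"
proof
  fix p
  show "coord_proj L (point_of v) p = v p"
  proof (cases p)
    case (Pair s i)
    then show ?thesis
      using assms by (cases "p \<in> coords L")
        (auto simp: coord_proj_def mem_coords_iff point_of_nth PiE_def extensional_def)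
  qed
qed

lemma restrict_coord_proj:
  fixes L L' :: "nat ^ 'd"
  assumes "\<And>s. L $ s \<le> L' $ s"
  shows "restrict (coord_proj L' \<theta>) (coords L) = coord_proj L \<theta>"
  using coords_mono[of L L', OF assms] by (auto simp: coord_proj_def restrict_def fun_eq_iff)

lemma point_of_in_cylinder: "v \<in> coords L \<rightarrow>\<^sub>E UNIV \<Longrightarrow> point_of v \<in> cylinder L v"
  by (simp add: cylinder_def point_of_in_unit_cube coord_proj_point_of)

lemma cylinder_nonempty: "C \<in> cylinders L \<Longrightarrow> C \<noteq> {}"
  unfolding cylinders_def using point_of_in_cylinder by blast

lemma finite_cylinders: "finite (cylinders L)"
  by (simp add: cylinders_def finite_coords finite_PiE)

text \<open>Every point of a cylinder serves as its centre, as for balls in an ultrametric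
  space.\<close>

lemma cylinder_eq_point:
  assumes "C \<in> cylinders L" "x \<in> C"
  shows "C = {y \<in> unit_cube. coord_proj L y = coord_proj L x}"
  using assms by (auto simp: cylinders_def cylinder_def)

lemma cylinder_subset_unit_cube: "C \<in> cylinders L \<Longrightarrow> C \<subseteq> unit_cube"
  by (auto simp: cylinders_def cylinder_def)

lemma cylinder_of_point:
  assumes "x \<in> unit_cube" shows "\<exists>C\<in>cylinders L. x \<in> C"
  using assms by (force simp: cylinders_def cylinder_def coord_proj_def)

lemma unit_cube_in_cylinders: "unit_cube \<in> cylinders (0 :: nat ^ 'd)"
proof -
  have "coords (0 :: nat ^ 'd) = {}" by (auto simp: coords_def)
  then show ?thesis
    by (auto simp: cylinders_def cylinder_def coord_proj_def)
qed

text \<open>Centre both cylinders at a common point: agreement on the longer digit block restricts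
  to agreement on the shorter one.\<close>

lemma cylinders_nested:
  fixes L L' :: "nat ^ 'd"
  assumes "\<And>s. L $ s \<le> L' $ s" "C \<in> cylinders L" "D \<in> cylinders L'" "C \<inter> D \<noteq> {}"
  shows "D \<subseteq> C"
proof -
  obtain x where x: "x \<in> C" "x \<in> D" using assms by blast
  show ?thesis
    unfolding cylinder_eq_point[OF assms(2) x(1)] cylinder_eq_point[OF assms(3) x(2)]
    using restrict_coord_proj[OF assms(1)] by (metis (mono_tags, lifting) Collect_mono)
qed

lemma cylinders_disjoint:
  "C \<in> cylinders L \<Longrightarrow> D \<in> cylinders L \<Longrightarrow> C \<inter> D \<noteq> {} \<Longrightarrow> C = D"
  using cylinders_nested[of L L] by (metis Int_commute order_refl subset_antisym)

text \<open>Otherwise adding 1 to the digit \<open>(s, L $ s)\<close> of a point of \<open>C\<close>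
  is invisible at length \<open>L'\<close> but leaves the cylinder at length
  \<open>L\<close>.\<close>

lemma cylinder_length_le:
  fixes L L' :: "nat ^ 'd"
  assumes "C \<in> cylinders L" "C \<in> cylinders L'"
  shows "L $ s \<le> L' $ s"
proof (rule ccontr)
  assume "\<not> ?thesis"
  then have s: "L' $ s < L $ s" by simp
  obtain v where v: "v \<in> coords L \<rightarrow>\<^sub>E UNIV" "C = cylinder L v"
    using assms(1) by (auto simp: cylinders_def)
  define x where "x = point_of v"
  define y where "y = point_of (v((s, L $ s) := v (s, L $ s) + 1))"
  have x: "x \<in> C" using v point_of_in_cylinder by (simp add: x_def)
  have "coord_proj L' y = coord_proj L' x"
    using s by (auto simp: coord_proj_def x_def y_def fun_eq_iff restrict_def mem_coords_iff
        point_of_nth)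
  then have "y \<in> C" using cylinder_eq_point[OF assms(2) x]
    by (simp add: y_def point_of_in_unit_cube)
  then have "coord_proj L y (s, L $ s) = coord_proj L x (s, L $ s)"
    using cylinder_eq_point[OF assms(1) x] by simp
  then show False using s
    by (simp add: coord_proj_def mem_coords_iff x_def y_def point_of_nth)
qed

text \<open>This pins down the length that is existentially quantified in
  \<open>refine_cylinders\<close>.\<close>

lemma cylinder_length_unique:
  "C \<in> cylinders L \<Longrightarrow> C \<in> cylinders L' \<Longrightarrow> L = L'"
  by (simp add: vec_eq_iff antisym cylinder_length_le)

text \<open>The digits on \<open>coords L\<close> are forced by \<open>C\<close>, and those on
  \<open>coords L' - coords L\<close> are free; \<open>glue\<close> joins the two blocks, giving a
  bijection.\<close>

lemma card_subcylinders:
  fixes L L' :: "nat ^ 'd" and C :: "('a::{field,finite} fls ^ 'd) set"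
  assumes le: "\<And>s. L $ s \<le> L' $ s" and C: "C \<in> cylinders L"
  shows "card {D \<in> cylinders L'. D \<subseteq> C} = CARD('a) ^ (total_length L' - total_length L)"
proof -
  have sub: "coords L \<subseteq> coords L'" using coords_mono le by blast
  obtain u where u: "u \<in> coords L \<rightarrow>\<^sub>E UNIV" "C = cylinder L u"
    using C by (auto simp: cylinders_def)
  define glue where
    "glue v = (\<lambda>p. if p \<in> coords L then u p else v p)" for v :: "'d \<times> nat \<Rightarrow> 'a"
  have glue: "glue v \<in> coords L' \<rightarrow>\<^sub>E UNIV" "restrict (glue v) (coords L) = u"
    "restrict (glue v) (coords L' - coords L) = v"
    if "v \<in> (coords L' - coords L) \<rightarrow>\<^sub>E UNIV" for v
    using that u sub by (auto simp: glue_def PiE_def extensional_def fun_eq_iff restrict_def)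
  have "bij_betw (\<lambda>v. cylinder L' (glue v)) ((coords L' - coords L) \<rightarrow>\<^sub>E UNIV)
    {D \<in> cylinders L'. D \<subseteq> C}"
  proof (rule bij_betwI')
    fix v v' assume v: "v \<in> (coords L' - coords L) \<rightarrow>\<^sub>E (UNIV :: 'a set)"
      "v' \<in> (coords L' - coords L) \<rightarrow>\<^sub>E (UNIV :: 'a set)"
    have "glue v = glue v'" if "cylinder L' (glue v) = cylinder L' (glue v')"
    proof -
      have "point_of (glue v) \<in> cylinder L' (glue v')"
        using point_of_in_cylinder[OF glue(1)[OF v(1)]] that by simp
      then show ?thesis
        by (simp add: cylinder_def coord_proj_point_of[OF glue(1)[OF v(1)]])
    qed
    then show "(cylinder L' (glue v) = cylinder L' (glue v')) = (v = v')"
      using glue(3)[OF v(1)] glue(3)[OF v(2)] by metis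
  next
    fix v assume v: "v \<in> (coords L' - coords L) \<rightarrow>\<^sub>E (UNIV :: 'a set)"
    have "cylinder L' (glue v) \<subseteq> C"
    proof
      fix x assume "x \<in> cylinder L' (glue v)"
      then show "x \<in> C"
        using glue(2)[OF v] restrict_coord_proj[of L L' x, OF le] by (simp add: u cylinder_def)
    qed
    then show "cylinder L' (glue v) \<in> {D \<in> cylinders L'. D \<subseteq> C}"
      using glue(1)[OF v] by (auto simp: cylinders_def)
  next
    fix D assume "D \<in> {D \<in> cylinders L'. D \<subseteq> C}"
    then obtain w where w: "w \<in> coords L' \<rightarrow>\<^sub>E UNIV" "D = cylinder L' w" "D \<subseteq> C"
      by (auto simp: cylinders_def)
    have "point_of w \<in> C" using w point_of_in_cylinder by blast
    then have w_L: "u = restrict w (coords L)"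
      using restrict_coord_proj[of L L' "point_of w", OF le] w coord_proj_point_of[OF w(1)]
      by (simp add: u cylinder_def)
    have "glue (restrict w (coords L' - coords L)) = w"
      using w(1) sub by (auto simp: glue_def fun_eq_iff PiE_def extensional_def w_L)
    then show "\<exists>v\<in>(coords L' - coords L) \<rightarrow>\<^sub>E UNIV. D = cylinder L' (glue v)"
      using w(2) by (intro bexI[of _ "restrict w (coords L' - coords L)"]) auto
  qed
  then have "card {D \<in> cylinders L'. D \<subseteq> C} = card ((coords L' - coords L) \<rightarrow>\<^sub>E (UNIV :: 'a set))"
    by (simp add: bij_betw_same_card)
  also have "\<dots> = CARD('a) ^ card (coords L' - coords L)"
    by (simp add: card_PiE finite_coords)
  finally show ?thesis
    by (simp add: card_Diff_subset[OF finite_coords sub] card_coords)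
qed

text \<open>Takes the place of a compactness argument: each digit is read off the first cylinder
  that fixes it, and nesting makes all later cylinders agree with it.\<close>

lemma nested_cylinders_intersect:
  fixes L :: "nat \<Rightarrow> nat ^ 'd" and c :: "nat \<Rightarrow> ('a::{field,finite} fls ^ 'd) set"
  assumes c: "\<And>m. c m \<in> cylinders (L m)" and nested: "\<And>m. c (Suc m) \<subseteq> c m"
    and unbounded: "\<And>s i. \<exists>m. i \<le> L m $ s"
  shows "\<exists>x. \<forall>m. x \<in> c m"
proof -
  obtain y where y: "\<And>m. y m \<in> c m"
    using cylinder_nonempty[OF c] unfolding ex_in_conv[symmetric] by metis
  have anti: "c N \<subseteq> c m" if "m \<le> N" for m N
    using lift_Suc_antimono_le[of c, OF nested that] .
  define N where "N s i = (LEAST m. i \<le> L m $ s)" for s i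
  define x where "x = point_of (\<lambda>(s, i). fls_nth (y (N s i) $ s) (int i))"
  have "fls_nth (x $ s) (int i) = fls_nth (y m $ s) (int i)" if i: "1 \<le> i" "i \<le> L m $ s" for m s i
  proof -
    have N: "i \<le> L (N s i) $ s" "N s i \<le> m"
      using unbounded[of i s] i unfolding N_def by (auto intro: LeastI_ex Least_le)
    have "y m \<in> c (N s i)" using anti[OF N(2)] y by blast
    then have "coord_proj (L (N s i)) (y m) (s, i) = coord_proj (L (N s i)) (y (N s i)) (s, i)"
      using cylinder_eq_point[OF c y] by auto
    then show ?thesis using i N by (simp add: x_def point_of_nth coord_proj_def mem_coords_iff)
  qed
  then have "coord_proj (L m) x = coord_proj (L m) (y m)" for m
    by (auto simp: coord_proj_def restrict_def fun_eq_iff mem_coords_iff)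
  then have "x \<in> c m" for m
    using cylinder_eq_point[OF c y] by (simp add: x_def point_of_in_unit_cube)
  then show ?thesis by blast
qed

section \<open>Counting in the Cantor construction\<close>

lemma total_length_add: "total_length (L + L') = total_length L + total_length L'"
  by (simp add: total_length_def sum.distrib)

lemma total_length_sum: "total_length (\<Sum>k<n. l k) = (\<Sum>k<n. total_length (l k))"
  unfolding total_length_def sum_component by (rule sum.swap)

lemma cantor_level_cylinders:
  fixes l :: "nat \<Rightarrow> nat ^ 'd"
  assumes "cantor_construction l l' \<C>"
  shows "\<C> m \<subseteq> cylinders (\<Sum>k<m. l k)"
proof (induction m)
  case 0
  then show ?case using assms unit_cube_in_cylinders by (simp add: cantor_construction_def)
next
  case (Suc m)
  show ?case
  proof
    fix D assume "D \<in> \<C> (Suc m)"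
    then have "D \<in> refine_cylinders (l m) (\<C> m)"
      using assms by (auto simp: cantor_construction_def)
    then obtain L C where C: "C \<in> \<C> m" "C \<in> cylinders L" and D: "D \<in> cylinders (L + l m)"
      unfolding refine_cylinders_def by blast
    have "C \<in> cylinders (\<Sum>k<m. l k)" using Suc C(1) by blast
    then have "L = (\<Sum>k<m. l k)" by (rule cylinder_length_unique[OF C(2)])
    then show "D \<in> cylinders (\<Sum>k<Suc m. l k)" using D by simp
  qed
qed

text \<open>The construction prescribes how many subcylinders are removed, so the children are
  counted as the complement of the removed ones among all subcylinders of the next length.\<close>

lemma card_cantor_children:
  fixes l :: "nat \<Rightarrow> nat ^ 'd" and \<C> :: "nat \<Rightarrow> ('a::{field,finite} fls ^ 'd) set set"
  assumes \<C>: "cantor_construction l l' \<C>" and C: "C \<in> \<C> m"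
  shows "card {D \<in> \<C> (Suc m). D \<subseteq> C} = CARD('a) ^ total_length (l m) - CARD('a) ^ l' m"
proof -
  let ?S = "\<Sum>k<m. l k"
  let ?R = "{D \<in> cylinders (?S + l m). D \<subseteq> C}"
  have CS: "C \<in> cylinders ?S" using cantor_level_cylinders[OF \<C>] C by blast
  have R: "refine_cylinders (l m) {C} = ?R"
  proof (intro subset_antisym subsetI)
    fix D assume "D \<in> refine_cylinders (l m) {C}"
    then obtain L where L: "C \<in> cylinders L" and D: "D \<in> cylinders (L + l m)" "D \<subseteq> C"
      unfolding refine_cylinders_def by blast
    show "D \<in> ?R" using D unfolding cylinder_length_unique[OF L CS] by blast
  next
    fix D assume "D \<in> ?R"
    then show "D \<in> refine_cylinders (l m) {C}" unfolding refine_cylinders_def using CS by blast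
  qed
  have fin: "finite ?R" by (rule finite_subset[OF _ finite_cylinders[of "?S + l m"]]) blast
  have "{D \<in> \<C> (Suc m). D \<subseteq> C} = ?R - (?R - \<C> (Suc m))"
    using cantor_level_cylinders[OF \<C>, of "Suc m"] unfolding sum.lessThan_Suc by blast
  moreover have "card (?R - \<C> (Suc m)) = CARD('a) ^ l' m"
    using \<C> C by (simp add: cantor_construction_def flip: R)
  moreover have "card ?R = CARD('a) ^ total_length (l m)"
    using card_subcylinders[of ?S "?S + l m", OF _ CS] by (simp add: total_length_add)
  ultimately show ?thesis using fin by (simp add: card_Diff_subset)
qed

text \<open>As \<open>k \<le> t - 1\<close>, at most the fraction 1/q of the \<open>q ^ t\<close>
  subcylinders is removed.\<close>

lemma children_lower_bound:
  fixes q :: nat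
  assumes "q \<ge> 2" "k < t"
  shows "real (q ^ t - q ^ k) \<ge> real q ^ t * ((real q - 1) / real q)" "q ^ t - q ^ k > 0"
proof -
  have lt: "q ^ k < q ^ t" using assms by (intro power_strict_increasing) auto
  then show "q ^ t - q ^ k > 0" by simp
  obtain j where j: "t = Suc j" "k \<le> j" using assms by (cases t) auto
  have "real q ^ k \<le> real q ^ j" using assms j by (intro power_increasing) auto
  then have "real q ^ t * ((real q - 1) / real q) \<le> real q ^ t - real q ^ k"
    using assms by (simp add: j field_simps)
  also have "\<dots> = real (q ^ t - q ^ k)" using lt by (simp add: of_nat_diff)
  finally show "real (q ^ t - q ^ k) \<ge> real q ^ t * ((real q - 1) / real q)" .
qed

text \<open>The numerator is bounded by the number of all cylinders of the level-\<open>n\<close>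
  length inside \<open>V\<close>. In the denominator each stage loses at most a factor (q - 1)/q,
  and the powers of q from the total length cancel.\<close>

lemma cantor_mass_of_cube:
  fixes l :: "nat \<Rightarrow> nat ^ 'd" and \<C> :: "nat \<Rightarrow> ('a::{field,finite} fls ^ 'd) set set"
  assumes \<C>: "cantor_construction l l' \<C>"
    and l': "\<And>m. l' m < total_length (l m)"
    and V: "V \<in> cylinders (\<chi> s. r)" and r: "r \<le> min_partial_sum l n"
  shows "real (card {D \<in> \<C> n. D \<subseteq> V}) / real (\<Prod>k<n. CARD('a) ^ total_length (l k) - CARD('a) ^ l' k)
    \<le> (real CARD('a) / (real CARD('a) - 1)) ^ n * real CARD('a) powr (- (real CARD('d) * real r))"
proof -
  define q where "q = real CARD('a)"
  let ?S = "\<Sum>k<n. l k"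
  let ?K = "\<lambda>k. CARD('a) ^ total_length (l k) - CARD('a) ^ l' k"
  have q: "q > 1" using card_field_ge_2[where 'a='a] by (simp add: q_def)
  have r_le: "r \<le> ?S $ s" for s
  proof -
    have "min_partial_sum l n \<le> (\<Sum>k<n. l k $ s)"
      unfolding min_partial_sum_def by (intro Min_le) auto
    then show ?thesis using r by simp
  qed
  have len: "total_length ((\<chi> s. r) :: nat ^ 'd) = CARD('d) * r" by (simp add: total_length_def)
  \<comment> \<open>Ensures that the truncated subtraction in the exponent below is a true
    difference.\<close>
  have le: "CARD('d) * r \<le> total_length ?S"
    unfolding len[symmetric] total_length_def using r_le by (intro sum_mono) simp
  have "card {D \<in> \<C> n. D \<subseteq> V} \<le> card {D \<in> cylinders ?S. D \<subseteq> V}"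
    using cantor_level_cylinders[OF \<C>, of n] finite_cylinders[of ?S] by (intro card_mono) auto
  also have "\<dots> = CARD('a) ^ (total_length ?S - CARD('d) * r)"
    using card_subcylinders[OF _ V, of ?S] r_le len by simp
  finally have "real (card {D \<in> \<C> n. D \<subseteq> V}) \<le> real (CARD('a) ^ (total_length ?S - CARD('d) * r))"
    by (rule of_nat_mono)
  also have "\<dots> = q ^ total_length ?S / q ^ (CARD('d) * r)"
    using le q unfolding of_nat_power q_def[symmetric] by (intro power_diff) auto
  also have "q ^ (CARD('d) * r) = q powr (real CARD('d) * real r)"
    using q by (simp flip: powr_realpow)
  also have "q ^ total_length ?S / q powr (real CARD('d) * real r)
    = q ^ total_length ?S * q powr (- (real CARD('d) * real r))"
    by (simp add: powr_minus divide_inverse)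
  finally have card_le:
    "real (card {D \<in> \<C> n. D \<subseteq> V}) \<le> q ^ total_length ?S * q powr (- (real CARD('d) * real r))" .
  have "q ^ total_length ?S * ((q - 1) / q) ^ n = (\<Prod>k<n. q ^ total_length (l k) * ((q - 1) / q))"
    by (simp add: total_length_sum power_sum prod.distrib del: times_divide_eq_right)
  also have "\<dots> \<le> (\<Prod>k<n. real (?K k))"
  proof (rule prod_mono)
    fix k
    have "0 \<le> q ^ total_length (l k) * ((q - 1) / q)" using q by simp
    moreover have "q ^ total_length (l k) * ((q - 1) / q) \<le> real (?K k)"
      unfolding q_def by (rule children_lower_bound(1)[OF card_field_ge_2 l'])
    ultimately show "0 \<le> q ^ total_length (l k) * ((q - 1) / q) \<and>
      q ^ total_length (l k) * ((q - 1) / q) \<le> real (?K k)" ..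
  qed
  also have "\<dots> = real (\<Prod>k<n. ?K k)" by simp
  finally have prod_ge: "q ^ total_length ?S * ((q - 1) / q) ^ n \<le> real (\<Prod>k<n. ?K k)" .
  have "real (card {D \<in> \<C> n. D \<subseteq> V}) / real (\<Prod>k<n. ?K k)
    \<le> (q ^ total_length ?S * q powr (- (real CARD('d) * real r))) / (q ^ total_length ?S * ((q - 1) / q) ^ n)"
    using q by (intro frac_le[OF _ card_le _ prod_ge] mult_pos_pos) simp_all
  also have "\<dots> = (q / (q - 1)) ^ n * q powr (- (real CARD('d) * real r))"
  proof -
    have "q ^ total_length ?S \<noteq> 0" "q \<noteq> 0" "q - 1 \<noteq> 0" using q by auto
    then show ?thesis by (simp add: power_divide)
  qed
  finally show ?thesis unfolding q_def .
qed

section \<open>From the upper limit to a growth bound\<close>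

text \<open>The limsup condition at index \<open>m - 1\<close> has numerator exactly
  \<open>m\<close>, and \<open>M (m - 1) < r\<close> then bounds the power. The finitely many small
  \<open>m\<close> go into \<open>A\<close>.\<close>

lemma power_le_of_limsup:
  fixes q a :: real and M :: "nat \<Rightarrow> nat"
  assumes q: "q > 1" and M: "filterlim M at_top sequentially"
    and a: "limsup (\<lambda>m. ereal ((real m + 1) / real (M m) * (ln (q / (q - 1)) / ln q))) < ereal a"
  obtains A where "A > 0"
    "\<And>m r. (\<And>k. k < m \<Longrightarrow> M k < r) \<Longrightarrow> (q / (q - 1)) ^ m \<le> A * q powr (a * real r)"
proof -
  let ?p = "q / (q - 1)"
  have p: "?p \<ge> 1" using q by simp
  have "\<forall>\<^sub>F m in sequentially. (real m + 1) / real (M m) * (ln ?p / ln q) < a"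
    using Limsup_lessD[OF a] by simp
  \<comment> \<open>Discards indices with \<open>M m = 0\<close>, where the quotient has the default
    value 0 and carries no information.\<close>
  moreover have "\<forall>\<^sub>F m in sequentially. M m \<ge> 1"
    using M by (simp add: filterlim_at_top)
  ultimately have "\<forall>\<^sub>F m in sequentially. (real m + 1) / real (M m) * (ln ?p / ln q) < a \<and> M m \<ge> 1"
    by (rule eventually_conj)
  then obtain m0 where
    m0: "\<And>m. m \<ge> m0 \<Longrightarrow> (real m + 1) / real (M m) * (ln ?p / ln q) < a \<and> M m \<ge> 1"
    unfolding eventually_sequentially by blast
  \<comment> \<open>A nonnegative term below \<open>a\<close> makes \<open>a\<close> positive, so
    \<open>a * M j\<close> may be replaced by \<open>a * r\<close>.\<close>
  have "0 \<le> (real m0 + 1) / real (M m0) * (ln ?p / ln q)" using q p by simp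
  then have a0: "a > 0" using m0[of m0] by simp
  define A where "A = ?p ^ Suc m0"
  have A1: "A \<ge> 1" unfolding A_def using p by (rule one_le_power)
  show ?thesis
  proof
    show "A > 0" using A1 by simp
  next
    fix m r assume below: "\<And>k. k < m \<Longrightarrow> M k < r"
    have r1: "q powr (a * real r) \<ge> 1" using q a0 by (intro ge_one_powr_ge_zero) auto
    show "?p ^ m \<le> A * q powr (a * real r)"
    proof (cases "m \<le> Suc m0")
      case True
      then have "?p ^ m \<le> A" unfolding A_def using p by (intro power_increasing)
      also have "\<dots> \<le> A * q powr (a * real r)" using A1 r1 by simp
      finally show ?thesis .
    next
      case False
      then obtain j where j: "m = Suc j" "m0 \<le> j" by (cases m) auto
      have "(real j + 1) * ln ?p \<le> a * real (M j) * ln q"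
        using m0[OF j(2)] q pos_divide_less_eq[of "real (M j) * ln q" "(real j + 1) * ln ?p" a]
        by (simp add: mult.assoc)
      also have "\<dots> \<le> a * real r * ln q"
        using below[of j] j a0 q by simp
      finally have "exp (real m * ln ?p) \<le> exp (a * real r * ln q)" by (simp add: j algebra_simps)
      also have "exp (real m * ln ?p) = ?p ^ m"
        using q by (simp add: exp_of_nat_mult)
      also have "exp (a * real r * ln q) = q powr (a * real r)" using q by (simp add: powr_def)
      also have "\<dots> \<le> A * q powr (a * real r)"
        using mult_right_mono[OF A1, of "q powr (a * real r)"] by simp
      finally show ?thesis .
    qed
  qed
qed

section \<open>Enlarging covering sets to cubes\<close>

lemma subset_cylinder_of_small_diam:
  fixes U :: "('a::{field,finite} fls ^ 'd) set"
  assumes fin: "diam_wrt laurent_dist U < \<infinity>"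
    and t: "t = 0 \<or> enn2real (diam_wrt laurent_dist U) < real CARD('a) powr (- real t)"
  shows "\<exists>V\<in>cylinders (\<chi> s. t). U \<inter> unit_cube \<subseteq> V"
proof (cases "U \<inter> unit_cube = {}")
  case True
  then show ?thesis using cylinder_of_point[OF point_of_in_unit_cube] by (metis empty_subsetI)
next
  case False
  then obtain x where x: "x \<in> U" "x \<in> unit_cube" by blast
  then obtain V where V: "V \<in> cylinders (\<chi> s. t)" "x \<in> V" using cylinder_of_point by blast
  have "y \<in> V" if y: "y \<in> U" "y \<in> unit_cube" for y
  proof -
    have "fls_nth (y $ s) (int i) = fls_nth (x $ s) (int i)" if i: "1 \<le> i" "i \<le> t" for s i
    proof -
      have "ennreal (laurent_dist x y) \<le> diam_wrt laurent_dist U"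
        unfolding diam_wrt_def using x y by (intro SUP_upper2[of x] SUP_upper2[of y]) auto
      \<comment> \<open>Finiteness matters here, since \<open>enn2real\<close> sends infinity to
        0.\<close>
      then have "laurent_dist x y \<le> enn2real (diam_wrt laurent_dist U)"
        using fin ennreal_le_iff[of "enn2real (diam_wrt laurent_dist U)" "laurent_dist x y"]
        by (simp add: ennreal_enn2real)
      moreover have "laurent_abs (x $ s - y $ s) \<le> laurent_dist x y"
        unfolding laurent_dist_def by (intro Max_ge) auto
      ultimately have "laurent_abs (x $ s - y $ s) < real CARD('a) powr (- real t)"
        using t i by auto
      also have "real CARD('a) powr (- real t) = real CARD('a) powi (- int t)"
        using card_field_ge_2[where 'a='a] by (simp add: powr_minus powr_realpow power_int_minus)
      finally show ?thesis using i by (auto simp: laurent_abs_less_iff)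
    qed
    then have "coord_proj (\<chi> s. t) y = coord_proj (\<chi> s. t) x"
      by (auto simp: coord_proj_def restrict_def fun_eq_iff mem_coords_iff)
    then show ?thesis using cylinder_eq_point[OF V] y by blast
  qed
  then show ?thesis using V by blast
qed

text \<open>
  The error \<open>\<epsilon>\<close> is needed only for sets of diameter zero, whose cost vanishes if \<open>s > 0\<close>.
\<close>

lemma enlarge_to_cylinder:
  fixes U :: "('a::{field,finite} fls ^ 'd) set" and A b s \<epsilon> :: real
  assumes fin: "diam_wrt laurent_dist U < \<infinity>" and A: "A > 0" and s: "0 \<le> s" "s < b" and \<epsilon>: "\<epsilon> > 0"
  shows "\<exists>t. \<exists>V\<in>cylinders (\<chi> s. t). U \<inter> unit_cube \<subseteq> V \<and>
    ennreal (A * real CARD('a) powr (- (b * real t)))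
      \<le> ennreal (A * real CARD('a) powr s) * diam_power laurent_dist s U + ennreal \<epsilon>"
proof -
  define q where "q = real CARD('a)"
  define D where "D = enn2real (diam_wrt laurent_dist U)"
  have q: "q > 1" using card_field_ge_2[where 'a='a] by (simp add: q_def)
  have tendsto: "(\<lambda>t. B * q powr (- (c * real t))) \<longlonglongrightarrow> 0" if "c > 0" for B c
    using q that by real_asymp
  have "\<exists>t. (t = 0 \<or> D < q powr (- real t)) \<and>
    ennreal (A * q powr (- (b * real t)))
      \<le> ennreal (A * q powr s) * diam_power laurent_dist s U + ennreal \<epsilon>"
  proof (cases "D = 0")
    case True
    \<comment> \<open>Diameter zero allows every \<open>t\<close>; one is taken so large that
      \<open>\<epsilon>\<close> alone pays.\<close>
    have "\<forall>\<^sub>F t in sequentially. A * q powr (- (b * real t)) < \<epsilon>"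
      using order_tendstoD(2)[OF tendsto[of b A] \<epsilon>] s by simp
    then obtain t where "A * q powr (- (b * real t)) < \<epsilon>"
      by (auto simp: eventually_sequentially)
    then have "ennreal (A * q powr (- (b * real t)))
      \<le> ennreal (A * q powr s) * diam_power laurent_dist s U + ennreal \<epsilon>"
      by (intro add_increasing) (auto simp: ennreal_leI)
    then show ?thesis using True q by (intro exI[of _ t]) auto
  next
    case False
    then have D: "D > 0" by (simp add: D_def order_less_le)
    have U: "U \<noteq> {}" using False by (auto simp: D_def diam_wrt_def bot_ennreal)
    have "\<forall>\<^sub>F t in sequentially. q powr (-1) * q powr (- (1 * real t)) < D"
      using order_tendstoD(2)[OF tendsto[of 1 "q powr (-1)"] D] by simp
    then obtain t where "q powr (-1) * q powr (- (1 * real t)) < D"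
      unfolding eventually_sequentially by blast
    also have "q powr (-1) * q powr (- (1 * real t)) = q powr (- (real t + 1))"
      unfolding powr_add[symmetric] by (simp add: algebra_simps)
    finally have ex: "\<exists>t. q powr (- (real t + 1)) \<le> D" by (meson less_imp_le)
    \<comment> \<open>The side of the cube matches \<open>D\<close> up to a factor q: minimality
      gives \<open>D < q powr (- real t)\<close>, except possibly for \<open>t = 0\<close>.\<close>
    define t where "t = (LEAST t. q powr (- (real t + 1)) \<le> D)"
    have t: "q powr (- (real t + 1)) \<le> D" using LeastI_ex[OF ex] unfolding t_def .
    have t_small: "t = 0 \<or> D < q powr (- real t)"
    proof (cases t)
      case (Suc j)
      then have "\<not> q powr (- (real j + 1)) \<le> D"
        using not_less_Least[of j "\<lambda>t. q powr (- (real t + 1)) \<le> D"]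
        unfolding t_def[symmetric] by simp
      then show ?thesis using Suc by (simp add: add.commute)
    qed simp
    have "s * real t \<le> b * real t" using s by (intro mult_right_mono) auto
    \<comment> \<open>The exponent \<open>b\<close> is first lowered to \<open>s\<close>; the factor
      \<open>q powr s\<close> then pays for the shift from \<open>t\<close> to
      \<open>t + 1\<close>.\<close>
    then have "q powr (- (b * real t)) \<le> q powr (s + s * (- (real t + 1)))"
      using q by (intro powr_mono) (simp_all add: algebra_simps)
    also have "\<dots> = q powr s * (q powr (- (real t + 1))) powr s"
      by (simp add: powr_add powr_powr mult.commute)
    also have "\<dots> \<le> q powr s * D powr s"
      using t s by (intro mult_left_mono powr_mono2) auto
    finally have "A * q powr (- (b * real t)) \<le> A * q powr s * D powr s" using A by simp
    then have "ennreal (A * q powr (- (b * real t))) \<le> ennreal (A * q powr s) * ennreal (D powr s)"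
      using A by (simp add: ennreal_leI flip: ennreal_mult)
    \<comment> \<open>This includes \<open>s = 0\<close>: both sides are 1, because \<open>U\<close>
      is nonempty and \<open>D > 0\<close>.\<close>
    also have "ennreal (D powr s) = diam_power laurent_dist s U"
      using U D by (simp add: diam_power_def D_def)
    finally show ?thesis using t_small by (intro exI[of _ t]) (auto intro: add_increasing2)
  qed
  then obtain t where t: "t = 0 \<or> D < q powr (- real t)"
    and cost: "ennreal (A * q powr (- (b * real t)))
      \<le> ennreal (A * q powr s) * diam_power laurent_dist s U + ennreal \<epsilon>" by blast
  obtain V where "V \<in> cylinders (\<chi> s. t)" "U \<inter> unit_cube \<subseteq> V"
    using subset_cylinder_of_small_diam[OF fin t[unfolded D_def q_def]] by blast
  then show ?thesis using cost unfolding q_def by blast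
qed

section \<open>Positive Hausdorff measure and the dimension bound\<close>

lemma hausdorff_premeasure_lessE:
  assumes "hausdorff_premeasure \<rho> s \<delta> E < x"
  obtains U where "E \<subseteq> (\<Union>i. U i)" "\<And>i. diam_wrt \<rho> (U i) \<le> ennreal \<delta>"
    "(\<Sum>i. diam_power \<rho> s (U i)) < x"
proof -
  obtain z where z: "z \<in> {(\<Sum>i. diam_power \<rho> s (U i)) | U :: nat \<Rightarrow> _ set.
      E \<subseteq> (\<Union>i. U i) \<and> (\<forall>i. diam_wrt \<rho> (U i) \<le> ennreal \<delta>)}" "z < x"
    using assms unfolding hausdorff_premeasure_def Inf_less_iff by (elim bexE)
  then obtain U where "z = (\<Sum>i. diam_power \<rho> s (U i))" "E \<subseteq> (\<Union>i. U i)"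
    "\<forall>i. diam_wrt \<rho> (U i) \<le> ennreal \<delta>"
    by (elim CollectE exE conjE)
  with z(2) show ?thesis by (intro that) simp_all
qed

text \<open>Here the covering estimate, the mass estimate and the tree descent meet. The real number
  \<open>a\<close> leaves room above the limsup, so that the mass bound holds with a uniform
  constant.\<close>

lemma hausdorff_measure_pos:
  fixes l :: "nat \<Rightarrow> nat ^ 'd" and \<C> :: "nat \<Rightarrow> ('a::{field,finite} fls ^ 'd) set set"
  assumes \<C>: "cantor_construction l l' \<C>"
    and l': "\<And>m. l' m < total_length (l m)"
    and M: "filterlim (min_partial_sum l) at_top sequentially"
    and a: "limsup (\<lambda>m. ereal ((real m + 1) / real (min_partial_sum l m) *
             (ln (real CARD('a) / (real CARD('a) - 1)) / ln (real CARD('a))))) < ereal a"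
    and s: "0 \<le> s" "s < real CARD('d) - a"
  shows "hausdorff_measure laurent_dist s (\<Inter>m. \<Union>C\<in>\<C> m. C) \<noteq> 0"
proof
  assume zero: "hausdorff_measure laurent_dist s (\<Inter>m. \<Union>C\<in>\<C> m. C) = 0"
  define q where "q = real CARD('a)"
  define b where "b = real CARD('d) - a"
  define K where "K k = CARD('a) ^ total_length (l k) - CARD('a) ^ l' k" for k
  have q: "q > 1" using card_field_ge_2[where 'a='a] by (simp add: q_def)
  obtain A where A: "A > 0" and growth: "\<And>m r. (\<And>k. k < m \<Longrightarrow> min_partial_sum l k < r) \<Longrightarrow>
      (q / (q - 1)) ^ m \<le> A * q powr (a * real r)"
    using power_le_of_limsup[OF q M a[folded q_def]] by blast
  define B where "B = A * q powr s"
  have B: "B > 0" using A q by (simp add: B_def)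

  \<comment> \<open>Any positive scale would do; 1 serves to make the diameters finite. The
    threshold \<open>1 / (2 * B)\<close> costs half of the unit mass after multiplication by
    \<open>B\<close>.\<close>
  have "hausdorff_premeasure laurent_dist s 1 (\<Inter>m. \<Union>C\<in>\<C> m. C) \<le> 0"
    unfolding zero[symmetric] hausdorff_measure_def by (intro SUP_upper) auto
  also have "0 < ennreal (1 / (2 * B))" using B by simp
  finally obtain U where U_cover: "(\<Inter>m. \<Union>C\<in>\<C> m. C) \<subseteq> (\<Union>i. U i)"
    and U_diam: "\<And>i. diam_wrt laurent_dist (U i) \<le> ennreal 1"
    and U_sum: "(\<Sum>i. diam_power laurent_dist s (U i)) < ennreal (1 / (2 * B))"
    by (rule hausdorff_premeasure_lessE) (rule that; assumption)

  \<comment> \<open>These errors add up to the other half of the unit mass.\<close>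
  define \<epsilon> :: "nat \<Rightarrow> real" where "\<epsilon> i = (1/2) ^ Suc i / 2" for i
  have "\<exists>t. \<exists>V\<in>cylinders (\<chi> s. t). U i \<inter> unit_cube \<subseteq> V \<and>
    ennreal (A * q powr (- (b * real t)))
      \<le> ennreal B * diam_power laurent_dist s (U i) + ennreal (\<epsilon> i)" for i
  proof -
    have "diam_wrt laurent_dist (U i) < \<infinity>" by (rule le_less_trans[OF U_diam]) simp
    moreover note A s(1)
    moreover have "s < b" using s(2) by (simp add: b_def)
    moreover have "\<epsilon> i > 0" by (simp add: \<epsilon>_def)
    ultimately show ?thesis unfolding q_def B_def by (rule enlarge_to_cylinder)
  qed
  then obtain t V where V: "\<And>i. V i \<in> cylinders (\<chi> s. t i)" "\<And>i. U i \<inter> unit_cube \<subseteq> V i"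
    and V_cost: "\<And>i. ennreal (A * q powr (- (b * real (t i))))
      \<le> ennreal B * diam_power laurent_dist s (U i) + ennreal (\<epsilon> i)"
    by metis

  \<comment> \<open>The first level whose cylinders are nested in or disjoint from
    \<open>V i\<close>, as far as lengths tell; minimality supplies the hypothesis of
    \<open>growth\<close>.\<close>
  define n where "n i = (LEAST m. t i \<le> min_partial_sum l m)" for i
  have ex_level: "\<exists>m. r \<le> min_partial_sum l m" for r
    using M unfolding filterlim_at_top eventually_sequentially by blast
  have n: "t i \<le> min_partial_sum l (n i)" for i
    using LeastI_ex[OF ex_level] unfolding n_def .
  have n_least: "min_partial_sum l k < t i" if "k < n i" for k i
    using not_less_Least[OF that[unfolded n_def]] by simp
  have level_ge: "min_partial_sum l m \<le> (\<Sum>k<m. l k) $ s" for m s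
    unfolding min_partial_sum_def by (intro Min_le) auto

  have mass: "real (card {D \<in> \<C> (n i). D \<subseteq> V i}) / real (\<Prod>k<n i. K k) \<le> A * q powr (- (b * real (t i)))"
    for i
  proof -
    have "real (card {D \<in> \<C> (n i). D \<subseteq> V i}) / real (\<Prod>k<n i. K k)
      \<le> (q / (q - 1)) ^ n i * q powr (- (real CARD('d) * real (t i)))"
      unfolding K_def q_def by (rule cantor_mass_of_cube[OF \<C> l' V(1) n])
    also have "\<dots> \<le> A * q powr (a * real (t i)) * q powr (- (real CARD('d) * real (t i)))"
      using growth[OF n_least] by (intro mult_right_mono) auto
    also have "\<dots> = A * q powr (- (b * real (t i)))"
      unfolding mult.assoc powr_add[symmetric] by (simp add: b_def algebra_simps)
    finally show ?thesis .
  qed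
  have "\<epsilon> sums (1/2)"
    unfolding \<epsilon>_def by (rule sums_divide[OF power_half_series])
  then have \<epsilon>_sum: "(\<Sum>i. ennreal (\<epsilon> i)) = ennreal (1/2)"
    by (rule suminf_ennreal_eq[rotated]) (simp add: \<epsilon>_def)
  obtain y where y: "(\<Sum>i. diam_power laurent_dist s (U i)) = ennreal y" "y \<ge> 0"
    using U_sum by (cases "\<Sum>i. diam_power laurent_dist s (U i)") auto
  have "y < 1 / (2 * B)" using U_sum y by (simp add: ennreal_less_iff)
  then have yB: "B * y < 1 / 2" using B by (simp add: field_simps)
  have "(\<Sum>i. ennreal (real (card {D \<in> \<C> (n i). D \<subseteq> V i}) / real (\<Prod>k<n i. K k)))
    \<le> (\<Sum>i. ennreal B * diam_power laurent_dist s (U i) + ennreal (\<epsilon> i))"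
    using order_trans[OF ennreal_leI[OF mass] V_cost] by (intro suminf_le) auto
  also have "\<dots> = ennreal B * (\<Sum>i. diam_power laurent_dist s (U i)) + (\<Sum>i. ennreal (\<epsilon> i))"
    by (subst suminf_add[symmetric]) auto
  also have "\<dots> = ennreal (B * y + 1 / 2)"
    using B y(2) unfolding y(1) \<epsilon>_sum by (subst ennreal_plus) (simp_all add: ennreal_mult)
  also have "\<dots> < 1" using yB by (subst ennreal_less_one_iff) simp
  finally have small:
    "(\<Sum>i. ennreal (real (card {D \<in> \<C> (n i). D \<subseteq> V i}) / real (\<Prod>k<n i. K k))) < 1" .

  have level: "C \<in> cylinders (\<Sum>k<m. l k)" if "C \<in> \<C> m" for C m
    using cantor_level_cylinders[OF \<C>] that by blast
  have inside: "D \<subseteq> V i" if "D \<in> \<C> (n i)" "D \<inter> V i \<noteq> {}" for D i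
    using cylinders_nested[OF _ V(1) level[OF that(1)]] order_trans[OF n level_ge] that(2)
    by (simp add: Int_commute)
  have "\<exists>c. (\<forall>m. c m \<in> \<C> m \<and> c (Suc m) \<subseteq> c m) \<and> (\<forall>m i. \<not> c m \<subseteq> V i)"
  proof (rule tree_avoid[where K = K and n = n])
    show "\<C> 0 = {unit_cube}" using \<C> by (simp add: cantor_construction_def)
    show "finite (\<C> m)" for m
      using cantor_level_cylinders[OF \<C>] finite_cylinders finite_subset by blast
    show "{} \<notin> \<C> m" for m using level cylinder_nonempty by blast
    show "C = D" if "C \<in> \<C> m" "D \<in> \<C> m" "C \<inter> D \<noteq> {}" for m C D
      using cylinders_disjoint[OF level[OF that(1)] level[OF that(2)] that(3)] .
    show "\<exists>C\<in>\<C> m. D \<subseteq> C" if "D \<in> \<C> (Suc m)" for m D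
    proof -
      have "D \<in> refine_cylinders (l m) (\<C> m)"
        using \<C> that unfolding cantor_construction_def by blast
      then show ?thesis unfolding refine_cylinders_def by blast
    qed
    show "card {D \<in> \<C> (Suc m). D \<subseteq> C} = K m" if "C \<in> \<C> m" for m C
      unfolding K_def by (rule card_cantor_children[OF \<C> that])
    show "K m > 0" for m
      unfolding K_def by (rule children_lower_bound(2)[OF card_field_ge_2 l'])
    show "D \<subseteq> V i \<or> D \<inter> V i = {}" if "D \<in> \<C> (n i)" for i D
      using inside that by blast
  qed (rule small)
  then obtain c where c: "\<And>m. c m \<in> \<C> m" "\<And>m. c (Suc m) \<subseteq> c m" "\<And>m i. \<not> c m \<subseteq> V i"
    by blast
  \<comment> \<open>Since the minimum over coordinates diverges, every digit is fixed at some level,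
    and the branch has a common point.\<close>
  have "\<exists>m. i \<le> (\<Sum>k<m. l k) $ s" for s i
    using ex_level[of i] level_ge order_trans by blast
  then obtain x where x: "\<And>m. x \<in> c m"
    using nested_cylinders_intersect[where c = c and L = "\<lambda>m. \<Sum>k<m. l k"] level[OF c(1)] c(2)
    by blast
  then have "x \<in> (\<Inter>m. \<Union>C\<in>\<C> m. C)" using c(1) by blast
  then obtain i where "x \<in> U i" using U_cover by blast
  moreover have "x \<in> unit_cube" using cylinder_subset_unit_cube[OF level[OF c(1)]] x by blast
  ultimately have "x \<in> V i" using V(2) by blast
  \<comment> \<open>At level \<open>n i\<close>, meeting \<open>V i\<close> means lying inside it,
    which the branch avoids.\<close>
  then show False using inside[OF c(1)[of "n i"]] x[of "n i"] c(3) by blast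
qed

theorem theorem2p2:
  fixes l :: "nat \<Rightarrow> nat ^ 'd"
    and l' :: "nat \<Rightarrow> nat"
    and C_inf :: "('a::{field,finite} fls ^ 'd) set"
  assumes "\<And>m. l' m < total_length (l m)"
    and "is_cantor_set l l' C_inf"
    and "filterlim (min_partial_sum l) at_top sequentially"
  shows "hausdorff_dim laurent_dist C_inf \<ge>
           ereal (real CARD('d)) -
           limsup (\<lambda>m. ereal ((real m + 1) / real (min_partial_sum l m) *
             (ln (real CARD('a) / (real CARD('a) - 1)) / ln (real CARD('a)))))"
    (is "_ \<ge> _ - ?L")
proof -
  obtain \<C> where \<C>: "cantor_construction l l' \<C>" and C_inf: "C_inf = (\<Inter>m. \<Union>C\<in>\<C> m. C)"
    using assms(2) unfolding is_cantor_set_def by blast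
  have "ereal (real CARD('d)) - ?L \<le> ereal s"
    if s: "0 \<le> s" "hausdorff_measure laurent_dist s C_inf = 0" for s
  proof (rule ccontr)
    assume "\<not> ?thesis"
    \<comment> \<open>The value plus infinity of \<open>?L\<close> is ruled out: it would make the
      left-hand side minus infinity.\<close>
    then have "?L < ereal (real CARD('d) - s)" by (cases ?L) auto
    then obtain a where a: "?L < ereal a" "ereal a < ereal (real CARD('d) - s)"
      using ereal_dense2 by blast
    then have "s < real CARD('d) - a" by simp
    then show False
      using hausdorff_measure_pos[OF \<C> assms(1,3) a(1) s(1)] s(2) C_inf by blast
  qed
  then show ?thesis unfolding hausdorff_dim_def by (intro Inf_greatest) auto
qed

end
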